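(* Let $k\ge 2$ be an integer and $q$ a prime power, and let $\Gamma=[l^{(1)}],\langle r^{(1)}\rangle,[l^{(2)}],\langle r^{(2)}\rangle,\dots$ be a backtrackless walk in $\Lambda_{k,q}$ with $[l^{(1)}]=(0,0,\dots,0)\in L_k$ and $\langle r^{(1)}\rangle=(0,0,\dots,0)\in R_k$. Write $x_i=l^{(i)}_0$, $y_i=r^{(i)}_0$, $u_i=x_{i+1}-x_i$, $v_i=y_{i+1}-y_i$. Then for every $i\ge 1$ such that $[l^{(i+1)}]$ and $\langle r^{(i+1)}\rangle$ lie on $\Gamma$, and every $j\ge 0$ (with the coordinate index on the left-hand side at most $k$), $$l^{(i+1)}_{4j}=\rho_{i-j-1}(u_1,v_1,\dots,u_{i-1},v_{i-1},u_i),$$ $$l^{(i+1)}_{4j+1}=\rho_{i-j-2}(v_1,u_2,\dots,v_{i-1},u_i),$$ $$l^{(i+1)}_{4j+2}=y_{i+1}\,l^{(i+1)}_{4j}-\rho_{i-j-1}(u_1,v_1,\dots,u_i,v_i),$$ $$l^{(i+1)}_{4j+3}=y_{i+1}\,l^{(i+1)}_{4j+1}-\rho_{i-j-2}(v_1,u_2,\dots,v_{i-1},u_i,v_i).$$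
   Context: For a prime power $q$ and integer $k\ge2$, $\Lambda_{k,q}$ is the bipartite graph with vertex set $L_k\cup R_k$ (regarded as disjoint), where $L_k$ is the set of vectors $[l]=(l_0,l_1,\dots,l_k)\in\mathbb{F}_q^{k+1}$ with $l_1=l_2$ and $R_k$ is the set of vectors $\langle r\rangle=(r_0,r_1,\dots,r_k)\in\mathbb{F}_q^{k+1}$ with $r_1=0$; edges join only $L_k$ to $R_k$, and $[l]\sim\langle r\rangle$ iff for every $2\le i\le k$: $l_i+r_i=r_0l_{i-2}$ if $i\equiv 2,3\pmod 4$, and $l_i+r_i=l_0r_{i-2}$ if $i\equiv 0,1\pmod 4$. A backtrackless walk is a sequence of vertices $w_1,w_2,\dots$ with $w_i\sim w_{i+1}$ and $w_j\neq w_{j+2}$ for all relevant indices; $l^{(i)}_j$, $r^{(i)}_j$ denote the $(j+1)$-th coordinates of $[l^{(i)}]$, $\langle r^{(i)}\rangle$. For $\omega_1,\dots,\omega_n$ in $\mathbb{F}_q$: $\rho_0(\omega_1,\dots,\omega_n)=\omega_1\cdots\omega_n$; for $1\le s\le\lfloor n/2\rfloor$, $\rho_s(\omega_1,\dots,\omega_n)=\sum_{1\le i_1<\dots<i_s\le n-s}\prod_{j=1}^n\omega_j\big/\prod_{j=1}^s\omega_{i_j+j-1}\omega_{i_j+j}$, i.e. the sum, over all ways of deleting $s$ disjoint pairs of consecutive terms from the sequence, of the product of the remaining terms; $\rho_s(\omega_1,\dots,\omega_n)=0$ if $n<2s$ or $s<0$; for the empty sequence, $\rho_0=1$ and $\rho_s=0$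 for $s\ne0$. *)

theory Defs
  imports Complex_Main "HOL-Library.Extended_Nat"
begin

text \<open>
  A vector of \<open>F\<^sub>q\<^sup>k\<^sup>+\<^sup>1\<close> is a list of length \<open>k + 1\<close>, so that \<open>l ! j\<close> is the
  coordinate written \<open>l\<^sub>j\<close>. The field \<open>F\<^sub>q\<close> is a type of class \<open>{finite, field}\<close>,
  with \<open>q\<close> its cardinality.
\<close>

definition L_vecs :: "nat \<Rightarrow> 'a list set" where
  "L_vecs k = {l. length l = k + 1 \<and> l ! 1 = l ! 2}"

definition R_vecs :: "nat \<Rightarrow> 'a::zero list set" where
  "R_vecs k = {r. length r = k + 1 \<and> r ! 1 = 0}"

definition incident :: "nat \<Rightarrow> 'a::{finite,field} list \<Rightarrow> 'a list \<Rightarrow> bool" where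
  "incident k l r \<longleftrightarrow> (\<forall>i. 2 \<le> i \<and> i \<le> k \<longrightarrow>
     (i mod 4 \<in> {2, 3} \<longrightarrow> l ! i + r ! i = r ! 0 * l ! (i - 2)) \<and>
     (i mod 4 \<in> {0, 1} \<longrightarrow> l ! i + r ! i = l ! 0 * r ! (i - 2)))"

definition Lambda_verts :: "nat \<Rightarrow> ('a::{finite,field} list + 'a list) set" where
  "Lambda_verts k = L_vecs k <+> R_vecs k"

definition Lambda_adj ::
  "nat \<Rightarrow> 'a::{finite,field} list + 'a list \<Rightarrow> 'a list + 'a list \<Rightarrow> bool" where
  "Lambda_adj k v w \<longleftrightarrow> (\<exists>l\<in>L_vecs k. \<exists>r\<in>R_vecs k. incident k l r \<and>
     (v = Inl l \<and> w = Inr r \<or> v = Inr r \<and> w = Inl l))"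

text \<open>
  The walk \<open>w 1, w 2, \<dots>\<close> has \<open>N\<close> vertices, where \<open>N = \<infinity>\<close> is allowed; the values
  of \<open>w\<close> outside the positions \<open>1, \<dots>, N\<close> are irrelevant.
\<close>

definition backtrackless_walk ::
  "nat \<Rightarrow> enat \<Rightarrow> (nat \<Rightarrow> 'a::{finite,field} list + 'a list) \<Rightarrow> bool" where
  "backtrackless_walk k N w \<longleftrightarrow>
     (\<forall>i\<ge>1. enat i \<le> N \<longrightarrow> w i \<in> Lambda_verts k) \<and>
     (\<forall>i\<ge>1. enat (i + 1) \<le> N \<longrightarrow> Lambda_adj k (w i) (w (i + 1))) \<and>
     (\<forall>i\<ge>1. enat (i + 2) \<le> N \<longrightarrow> w i \<noteq> w (i + 2))"

text \<open>
  The ways of deleting \<open>s\<close> disjoint pairs of consecutive terms from a sequence of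
  length \<open>n\<close>: \<open>P\<close> is the set of (0-based) positions of the first terms of the deleted
  pairs. An index tuple \<open>1 \<le> i\<^sub>1 < \<dots> < i\<^sub>s \<le> n - s\<close> corresponds to
  \<open>P = {i\<^sub>j + j - 2 | 1 \<le> j \<le> s}\<close>.
\<close>

definition pair_deletions :: "nat \<Rightarrow> nat \<Rightarrow> nat set set" where
  "pair_deletions s n = {P. card P = s \<and> (\<forall>p\<in>P. p + 1 < n \<and> p + 1 \<notin> P)}"

text \<open>
  Multiplying the remaining terms, rather than dividing the full product by the deleted
  terms, keeps the definition meaningful when some term is zero. If \<open>n < 2 * s\<close> the sum
  is empty; for \<open>s = 0\<close> it has the single summand \<open>P = {}\<close>, the product of all terms.
\<close>

definition rho :: "int \<Rightarrow> 'a::comm_ring_1 list \<Rightarrow> 'a" where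
  "rho s ws =
     (if s < 0 then 0
      else \<Sum>P\<in>pair_deletions (nat s) (length ws).
             \<Prod>i\<in>{..<length ws} - (P \<union> (\<lambda>p. p + 1) ` P). ws ! i)"

end

theory Submission
  imports Defs
begin

text \<open>
  Subtracting the incidence equations of two consecutive left vectors with the right vector
  between them, and conversely, shows that the numbers
  \<open>l\<^sub>4\<^sub>j\<close>, \<open>r\<^sub>4\<^sub>j\<^sub>+\<^sub>2\<close> (and likewise \<open>l\<^sub>4\<^sub>j\<^sub>+\<^sub>1\<close>, \<open>r\<^sub>4\<^sub>j\<^sub>+\<^sub>3\<close>) along the walk satisfy the continuant
  recurrence \<open>\<rho>\<^sub>s(\<omega>\<^sub>1,\<dots>,\<omega>\<^sub>n) = \<omega>\<^sub>n \<rho>\<^sub>s(\<omega>\<^sub>1,\<dots>,\<omega>\<^sub>n\<^sub>-\<^sub>1) + \<rho>\<^sub>s\<^sub>-\<^sub>1(\<omega>\<^sub>1,\<dots>,\<omega>\<^sub>n\<^sub>-\<^sub>2)\<close>, which sorts the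
  deletions by whether the last term is deleted. The initial values of the two recurrences
  come from \<open>\<rho>\<^sub>n = 1\<close> on sequences of length \<open>2n\<close>.
\<close>

section \<open>Deletions of disjoint consecutive pairs\<close>

lemma pair_deletions_subset: "P \<in> pair_deletions s n \<Longrightarrow> P \<subseteq> {..<n}"
  by (force simp: pair_deletions_def)

lemma finite_pair_deletions: "finite (pair_deletions s n)"
  by (rule finite_subset[of _ "Pow {..<n}"]) (use pair_deletions_subset in auto)

text \<open>\<open>card P = 0\<close> also holds for infinite \<open>P\<close>, so emptiness needs
  the bound from \<open>pair_deletions_subset\<close>.\<close>

lemma pair_deletions_0: "pair_deletions 0 n = {{}}"
proof -
  have "P = {}" if "P \<in> pair_deletions 0 n" for P
    using that finite_subset[OF pair_deletions_subset[OF that]]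
    by (auto simp: pair_deletions_def)
  then show ?thesis
    by (auto simp: pair_deletions_def)
qed

text \<open>Sorts by whether the last possible pair, at positions \<open>n\<close> and
  \<open>n + 1\<close>, is deleted. If it is, no pair can start at \<open>n - 1\<close>, so all
  other pairs lie in the first \<open>n\<close> positions.\<close>

lemma pair_deletions_Suc_Suc:
  "pair_deletions (Suc s) (Suc (Suc n)) =
     pair_deletions (Suc s) (Suc n) \<union> insert n ` pair_deletions s n"
proof (intro equalityI subsetI)
  fix P assume P: "P \<in> pair_deletions (Suc s) (Suc (Suc n))"
  have fin: "finite P"
    using finite_subset[OF pair_deletions_subset[OF P]] by simp
  show "P \<in> pair_deletions (Suc s) (Suc n) \<union> insert n ` pair_deletions s n"
  proof (cases "n \<in> P")
    case True
    have bound: "p + 1 < n" if "p \<in> P - {n}" for p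
    proof -
      have "p \<noteq> n" "p + 1 < Suc (Suc n)" "p + 1 \<notin> P"
        using that P by (auto simp: pair_deletions_def)
      moreover have "p + 1 \<noteq> n"
        using \<open>p + 1 \<notin> P\<close> True by metis
      ultimately show ?thesis by linarith
    qed
    have "card (P - {n}) = s"
      using P True fin by (simp add: pair_deletions_def)
    then have "P - {n} \<in> pair_deletions s n"
      using bound P by (auto simp: pair_deletions_def)
    moreover have "P = insert n (P - {n})"
      using True by auto
    ultimately show ?thesis by blast
  next
    case False
    have "p + 1 < Suc n" if "p \<in> P" for p
    proof -
      have "p + 1 < Suc (Suc n)" "p \<noteq> n"
        using that P False by (auto simp: pair_deletions_def)
      then show ?thesis by linarith
    qed
    then show ?thesis
      using P by (auto simp: pair_deletions_def)
  qed
next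
  fix P assume "P \<in> pair_deletions (Suc s) (Suc n) \<union> insert n ` pair_deletions s n"
  then show "P \<in> pair_deletions (Suc s) (Suc (Suc n))"
  proof
    assume "P \<in> insert n ` pair_deletions s n"
    then obtain Q where Q: "Q \<in> pair_deletions s n" and P: "P = insert n Q"
      by auto
    have "finite Q" "n \<notin> Q"
      using pair_deletions_subset[OF Q] finite_subset by auto
    then show ?thesis
      using Q unfolding P pair_deletions_def by fastforce
  qed (auto simp: pair_deletions_def)
qed

text \<open>The recursion leads from \<open>(n, s)\<close> to \<open>(n - 1, s)\<close> and
  \<open>(n - 2, s - 1)\<close>, and both inherit the inequality.\<close>

lemma pair_deletions_empty: "n < 2 * s \<Longrightarrow> pair_deletions s n = {}"
proof (induction n arbitrary: s rule: less_induct)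
  case (less n)
  obtain s' where s: "s = Suc s'"
    using less.prems by (cases s) auto
  show ?case
  proof (cases "n < 2")
    case True
    then have "card P = 0" if "P \<in> pair_deletions s n" for P
      using that by (auto simp: pair_deletions_def card_eq_0_iff)
    then show ?thesis
      by (force simp: s pair_deletions_def)
  next
    case False
    then obtain n' where "n = Suc (Suc n')"
      by (metis less_2_cases_iff not0_implies_Suc One_nat_def)
    then show ?thesis
      using less.prems less.IH[of "Suc n'" s] less.IH[of n' s']
      by (simp add: s pair_deletions_Suc_Suc)
  qed
qed

section \<open>Recurrence and special values of \<open>rho\<close>\<close>

lemma rho_neg: "s < 0 \<Longrightarrow> rho s ws = 0"
  by (simp add: rho_def)

lemma rho_eq_0: "int (length ws) < 2 * s \<Longrightarrow> rho s ws = 0"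
  using pair_deletions_empty[of "length ws" "nat s"] by (simp add: rho_def)

lemma rho_0: "rho 0 ws = (\<Prod>i<length ws. ws ! i)"
  by (simp add: rho_def pair_deletions_0)

text \<open>For positive \<open>s\<close> this is \<open>pair_deletions_Suc_Suc\<close> summed with
  weights; for \<open>s = 0\<close> only full products occur, since \<open>rho (- 1) ws\<close>
  vanishes.\<close>

lemma rho_snoc_snoc:
  fixes a b :: "'a::comm_ring_1"
  shows "rho s (ws @ [a, b]) = b * rho s (ws @ [a]) + rho (s - 1) ws"
proof -
  consider "s < 0" | "s = 0" | t where "s = int (Suc t)"
    by (metis less_linear zero_less_imp_eq_int Suc_pred)
  then show ?thesis
  proof cases
    case 1
    then show ?thesis by (simp add: rho_neg)
  next
    case 2
    then show ?thesis
      by (simp add: rho_0 rho_neg nth_append mult.commute mult.left_commute)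
  next
    case (3 t)
    define n where "n = length ws"
    define f where "f xs P = (\<Prod>i\<in>{..<length xs} - (P \<union> (\<lambda>p. p + 1) ` P). xs ! i)"
      for xs :: "'a list" and P :: "nat set"
    have rho: "rho (int m) xs = (\<Sum>P\<in>pair_deletions m (length xs). f xs P)" for m xs
      by (simp add: rho_def f_def)
    have inj: "inj_on (insert n) (pair_deletions t n)"
      using pair_deletions_subset by (fastforce intro!: inj_onI simp: insert_ident)
    have disj: "pair_deletions (Suc t) (Suc n) \<inter> insert n ` pair_deletions t n = {}"
      by (auto simp: pair_deletions_def)
    \<comment> \<open>Every pair ends at position \<open>n\<close> or earlier, so \<open>b\<close>,
      at position \<open>n + 1\<close>, survives and factors out.\<close>
    have keep: "f (ws @ [a, b]) P = b * f (ws @ [a]) P"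
      if "P \<in> pair_deletions (Suc t) (Suc n)" for P
    proof -
      have sub: "p + 1 < Suc n" if "p \<in> P" for p
        using that \<open>P \<in> _\<close> by (auto simp: pair_deletions_def)
      have "{..<Suc (Suc n)} - (P \<union> (\<lambda>p. p + 1) ` P) =
          insert (Suc n) ({..<Suc n} - (P \<union> (\<lambda>p. p + 1) ` P))"
        using sub by fastforce
      then have "f (ws @ [a, b]) P =
          (ws @ [a, b]) ! Suc n *
          (\<Prod>i\<in>{..<Suc n} - (P \<union> (\<lambda>p. p + 1) ` P). (ws @ [a, b]) ! i)"
        by (simp add: f_def n_def)
      also have "(\<Prod>i\<in>{..<Suc n} - (P \<union> (\<lambda>p. p + 1) ` P). (ws @ [a, b]) ! i) = f (ws @ [a]) P"
        unfolding f_def by (rule prod.cong) (auto simp: n_def nth_append)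
      finally show ?thesis by (simp add: n_def nth_append)
    qed
    \<comment> \<open>The pair starting at \<open>n\<close> removes exactly \<open>a\<close> and
      \<open>b\<close>.\<close>
    have del: "f (ws @ [a, b]) (insert n P) = f ws P" if "P \<in> pair_deletions t n" for P
    proof -
      have sub: "p + 1 < n" if "p \<in> P" for p
        using that \<open>P \<in> _\<close> by (auto simp: pair_deletions_def)
      have "{..<Suc (Suc n)} - (insert n P \<union> (\<lambda>p. p + 1) ` insert n P) =
          {..<n} - (P \<union> (\<lambda>p. p + 1) ` P)"
        by auto
      then show ?thesis
        unfolding f_def by (intro prod.cong) (auto simp: n_def nth_append)
    qed
    have "rho s (ws @ [a, b]) =
        (\<Sum>P\<in>pair_deletions (Suc t) (Suc n). f (ws @ [a, b]) P) +
        (\<Sum>P\<in>insert n ` pair_deletions t n. f (ws @ [a, b]) P)"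
      unfolding 3 rho
      by (simp add: pair_deletions_Suc_Suc n_def[symmetric] sum.union_disjoint disj
          finite_pair_deletions)
    also have "\<dots> = b * rho s (ws @ [a]) + rho (int t) ws"
      unfolding 3 rho
      by (simp add: n_def[symmetric] sum.reindex[OF inj] keep del sum_distrib_left)
    finally show ?thesis by (simp add: 3)
  qed
qed

text \<open>In the recurrence the summand with factor \<open>b\<close> vanishes by
  \<open>rho_eq_0\<close>: a sequence of \<open>2 * n + 1\<close> terms cannot hold
  \<open>n + 1\<close> disjoint pairs. What remains is the same claim for two terms fewer.\<close>

lemma rho_full: "length ws = 2 * n \<Longrightarrow> rho (int n) ws = 1"
proof (induction n arbitrary: ws)
  case 0
  then show ?case by (simp add: rho_0)
next
  case (Suc n)
  obtain ws' a b where ws: "ws = ws' @ [a, b]"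
  proof -
    have "ws = take (2 * n) ws @ drop (2 * n) ws" "length (drop (2 * n) ws) = Suc (Suc 0)"
      using Suc.prems by auto
    then show ?thesis
      using that by (metis length_Suc_conv length_0_conv)
  qed
  then show ?case
    using Suc by (simp add: rho_snoc_snoc rho_eq_0)
qed

section \<open>Coordinates along a chain of incident vectors\<close>

text \<open>Sorting the indices by residue removes \<open>mod\<close> and truncated subtraction from
  all later arguments.\<close>

lemma incident_coordinates:
  assumes "incident k a b"
  shows "4 * j + 2 \<le> k \<Longrightarrow> a ! (4 * j + 2) + b ! (4 * j + 2) = b ! 0 * a ! (4 * j)"
    and "4 * j + 3 \<le> k \<Longrightarrow> a ! (4 * j + 3) + b ! (4 * j + 3) = b ! 0 * a ! (4 * j + 1)"
    and "4 * Suc j \<le> k \<Longrightarrow> a ! (4 * Suc j) + b ! (4 * Suc j) = a ! 0 * b ! (4 * j + 2)"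
    and "4 * Suc j + 1 \<le> k \<Longrightarrow>
      a ! (4 * Suc j + 1) + b ! (4 * Suc j + 1) = a ! 0 * b ! (4 * j + 3)"
proof -
  have inc: "(i mod 4 \<in> {2, 3} \<longrightarrow> a ! i + b ! i = b ! 0 * a ! (i - 2)) \<and>
      (i mod 4 \<in> {0, 1} \<longrightarrow> a ! i + b ! i = a ! 0 * b ! (i - 2))"
    if "2 \<le> i" "i \<le> k" for i
    using assms[unfolded incident_def, THEN spec, THEN mp, OF conjI[OF that]] .
  have mods: "(4 * j + 2) mod 4 = 2" "(4 * j + 3) mod 4 = 3"
      "(4 * Suc j) mod 4 = 0" "(4 * Suc j + 1) mod 4 = 1"
    and diffs: "4 * j + 2 - 2 = 4 * j" "4 * j + 3 - 2 = 4 * j + 1"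
      "4 * Suc j - 2 = 4 * j + 2" "4 * Suc j + 1 - 2 = 4 * j + 3"
    by presburger+
  show "4 * j + 2 \<le> k \<Longrightarrow> a ! (4 * j + 2) + b ! (4 * j + 2) = b ! 0 * a ! (4 * j)"
    using inc[of "4 * j + 2"] unfolding mods diffs by simp
  show "4 * j + 3 \<le> k \<Longrightarrow> a ! (4 * j + 3) + b ! (4 * j + 3) = b ! 0 * a ! (4 * j + 1)"
    using inc[of "4 * j + 3"] unfolding mods diffs by simp
  show "4 * Suc j \<le> k \<Longrightarrow> a ! (4 * Suc j) + b ! (4 * Suc j) = a ! 0 * b ! (4 * j + 2)"
    using inc[of "4 * Suc j"] unfolding mods diffs by simp
  show "4 * Suc j + 1 \<le> k \<Longrightarrow>
      a ! (4 * Suc j + 1) + b ! (4 * Suc j + 1) = a ! 0 * b ! (4 * j + 3)"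
    using inc[of "4 * Suc j + 1"] unfolding mods diffs by simp
qed

text \<open>
  Besides four coordinate families, the induction carries the identity
  \<open>y\<^sub>i\<^sub>+\<^sub>1 = \<rho>\<^sub>i\<^sub>-\<^sub>1(v\<^sub>1,u\<^sub>2,\<dots>,u\<^sub>i,v\<^sub>i)\<close>, which is what the first coordinate, subject to \<open>l\<^sub>1 = l\<^sub>2\<close>
  instead of a relation with an earlier coordinate of \<open>r\<close>, needs. At \<open>i = 0\<close> the lists mention
  the unused values \<open>u 0\<close> and \<open>v 0\<close>, but there all indices of \<open>rho\<close> are negative.
\<close>

lemma incident_chain_coordinates:
  fixes l r :: "nat \<Rightarrow> 'a::{finite,field} list"
  assumes k: "k \<ge> 2"
    and same: "\<And>i. 1 \<le> i \<Longrightarrow> i \<le> M \<Longrightarrow> incident k (l i) (r i)"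
    and succ: "\<And>i. 1 \<le> i \<Longrightarrow> i < M \<Longrightarrow> incident k (l (i + 1)) (r i)"
    and eq12: "\<And>i. 1 \<le> i \<Longrightarrow> i \<le> M \<Longrightarrow> l i ! 1 = l i ! 2"
    and l1: "l 1 = replicate (k + 1) 0"
    and r1: "r 1 = replicate (k + 1) 0"
    and u: "\<And>i. u i = l (i + 1) ! 0 - l i ! 0"
    and v: "\<And>i. v i = r (i + 1) ! 0 - r i ! 0"
    and M: "i < M"
  shows "(\<forall>j. 4 * j \<le> k \<longrightarrow> l (i + 1) ! (4 * j) =
        rho (int i - int j - 1) (concat (map (\<lambda>m. [u m, v m]) [1..<i]) @ [u i])) \<and>
    (\<forall>j. 4 * j + 1 \<le> k \<longrightarrow> l (i + 1) ! (4 * j + 1) =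
        rho (int i - int j - 2) (concat (map (\<lambda>m. [v m, u (m + 1)]) [1..<i]))) \<and>
    (\<forall>j. 4 * j + 2 \<le> k \<longrightarrow> r (i + 1) ! (4 * j + 2) =
        rho (int i - int j - 1) (concat (map (\<lambda>m. [u m, v m]) [1..<i + 1]))) \<and>
    (\<forall>j. 4 * j + 3 \<le> k \<longrightarrow> r (i + 1) ! (4 * j + 3) =
        rho (int i - int j - 2) (concat (map (\<lambda>m. [v m, u (m + 1)]) [1..<i]) @ [v i])) \<and>
    r (i + 1) ! 0 = rho (int i - 1) (concat (map (\<lambda>m. [v m, u (m + 1)]) [1..<i]) @ [v i])"
  using M
proof (induction i)
  case 0
  then show ?case
    using l1 r1 by (simp add: rho_neg del: replicate_Suc)
next
  case (Suc i)
  let ?U = "\<lambda>i. concat (map (\<lambda>m. [u m, v m]) [Suc 0..<i])"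
  let ?V = "\<lambda>i. concat (map (\<lambda>m. [v m, u (Suc m)]) [Suc 0..<i])"
  let ?l = "l (Suc i)" and ?r = "r (Suc i)" and ?l' = "l (Suc (Suc i))" and ?r' = "r (Suc (Suc i))"
  have IH:
    "\<And>j. 4 * j \<le> k \<Longrightarrow> ?l ! (4 * j) = rho (int i - int j - 1) (?U i @ [u i])"
    "\<And>j. 4 * j + 1 \<le> k \<Longrightarrow> ?l ! (4 * j + 1) = rho (int i - int j - 2) (?V i)"
    "\<And>j. 4 * j + 2 \<le> k \<Longrightarrow> ?r ! (4 * j + 2) = rho (int i - int j - 1) (?U (Suc i))"
    "\<And>j. 4 * j + 3 \<le> k \<Longrightarrow> ?r ! (4 * j + 3) = rho (int i - int j - 2) (?V i @ [v i])"
    "?r ! 0 = rho (int i - 1) (?V i @ [v i])"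
    using Suc.IH Suc.prems by simp_all
  have inc: "incident k ?l ?r" "incident k ?l' ?r" "incident k ?l' ?r'"
    using same[of "i + 1"] same[of "i + 2"] succ[of "i + 1"] Suc.prems by auto
  have u': "?l' ! 0 = ?l ! 0 + u (Suc i)" and v': "?r' ! 0 = ?r ! 0 + v (Suc i)"
    by (simp_all add: u v)

  \<comment> \<open>The bound on \<open>s\<close> matters at \<open>i = 0\<close>: it makes the
    index \<open>s - 1\<close> negative, so the arbitrary value \<open>u 0\<close> does not
    contribute.\<close>
  have rho_U_u: "rho s (?U (Suc i) @ [u (Suc i)]) =
      u (Suc i) * rho s (?U (Suc i)) + rho (s - 1) (?U i @ [u i])"
    if "s \<le> int i" for s
  proof (cases i)
    case 0
    then show ?thesis
      using that by (cases "s = 0") (auto simp: rho_neg rho_0)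
  next
    case (Suc n)
    then show ?thesis
      using rho_snoc_snoc[of s "?U i @ [u i]" "v i" "u (Suc i)"] by simp
  qed
  have rho_V_v: "rho s (?V (Suc i) @ [v (Suc i)]) =
      v (Suc i) * rho s (?V (Suc i)) + rho (s - 1) (?V i @ [v i])"
    if "s \<le> int i" for s
  proof (cases i)
    case 0
    then show ?thesis
      using that by (cases "s = 0") (auto simp: rho_neg rho_0)
  next
    case (Suc n)
    then show ?thesis
      using rho_snoc_snoc[of s "?V i @ [v i]" "u (Suc i)" "v (Suc i)"] by simp
  qed
  have rho_U: "rho s (?U (Suc (Suc i))) =
      v (Suc i) * rho s (?U (Suc i) @ [u (Suc i)]) + rho (s - 1) (?U (Suc i))" for s
    using rho_snoc_snoc[of s "?U (Suc i)" "u (Suc i)" "v (Suc i)"] by simp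
  \<comment> \<open>The bound is strict here: for \<open>i = 0\<close> and \<open>s = 0\<close> the
    equation would read \<open>1 = u 1 * v 0\<close>.\<close>
  have rho_V: "rho s (?V (Suc i)) = u (Suc i) * rho s (?V i @ [v i]) + rho (s - 1) (?V i)"
    if "s < int i" for s
  proof (cases i)
    case 0
    then show ?thesis
      using that by (simp add: rho_neg)
  next
    case (Suc n)
    then show ?thesis
      using rho_snoc_snoc[of s "?V i" "v i" "u (Suc i)"] by simp
  qed
  have len: "length (?U (Suc i)) = 2 * i" "length (?V (Suc i)) = 2 * i"
    by (induction i) auto

  have A: "?l' ! (4 * j) = rho (int i - int j) (?U (Suc i) @ [u (Suc i)])" if "4 * j \<le> k" for j
  proof (cases j)
    case 0
    \<comment> \<open>Here \<open>s = i\<close>, and \<open>rho_full\<close> gives the coefficient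
      of \<open>u (Suc i)\<close> the value 1, which matches \<open>u'\<close>.\<close>
    then show ?thesis
      using u' IH(1)[of 0] by (simp add: rho_U_u rho_full len del: upt_Suc)
  next
    case (Suc n)
    \<comment> \<open>Both left vectors are incident to \<open>?r\<close>; subtracting their
      equations cancels coordinate \<open>4 * j\<close> of \<open>?r\<close>.\<close>
    have "?l' ! (4 * j) = ?l ! (4 * j) + u (Suc i) * ?r ! (4 * n + 2)"
      using incident_coordinates(3)[OF inc(1), of n] incident_coordinates(3)[OF inc(2), of n] that
      unfolding Suc u' by algebra
    also have "?r ! (4 * n + 2) = rho (int i - int j) (?U (Suc i))"
      using IH(3)[of n] that by (simp add: Suc algebra_simps del: upt_Suc)
    finally show ?thesis
      unfolding IH(1)[OF that] by (simp add: rho_U_u del: upt_Suc)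
  qed
  have B: "?l' ! (4 * j + 1) = rho (int i - int j - 1) (?V (Suc i))" if "4 * j + 1 \<le> k" for j
  proof (cases j)
    case 0
    \<comment> \<open>Coordinate 1 has no incidence equation of its own, so that of coordinate 2
      stands in for it; the factor \<open>?r ! 0\<close> is then known from
      \<open>IH(5)\<close>.\<close>
    have "?l ! 1 = ?l ! 2" "?l' ! 1 = ?l' ! 2"
      using eq12[of "i + 1"] eq12[of "i + 2"] Suc.prems by auto
    moreover have "?l ! 2 + ?r ! 2 = ?r ! 0 * ?l ! 0" "?l' ! 2 + ?r ! 2 = ?r ! 0 * ?l' ! 0"
      using incident_coordinates(1)[OF inc(1), of 0] incident_coordinates(1)[OF inc(2), of 0] k by (simp_all only: mult_0_right add_0)
    then have "?l' ! 2 = ?l ! 2 + u (Suc i) * ?r ! 0"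
      unfolding u' by algebra
    ultimately have "?l' ! 1 = ?l ! 1 + u (Suc i) * ?r ! 0"
      by simp
    then show ?thesis
      using 0 IH(2)[of 0] IH(5) k by (simp add: rho_V del: upt_Suc)
  next
    case (Suc n)
    have "?l' ! (4 * j + 1) = ?l ! (4 * j + 1) + u (Suc i) * ?r ! (4 * n + 3)"
      using incident_coordinates(4)[OF inc(1), of n] incident_coordinates(4)[OF inc(2), of n] that
      unfolding Suc u' by algebra
    also have "?r ! (4 * n + 3) = rho (int i - int j - 1) (?V i @ [v i])"
      using IH(4)[of n] that by (simp add: Suc algebra_simps del: upt_Suc)
    finally show ?thesis
      unfolding IH(2)[OF that] by (simp add: rho_V del: upt_Suc)
  qed
  have C: "?r' ! (4 * j + 2) = rho (int i - int j) (?U (Suc (Suc i)))" if "4 * j + 2 \<le> k" for j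
  proof -
    \<comment> \<open>Now \<open>?r\<close> and \<open>?r'\<close> share the neighbour
      \<open>?l'\<close>, whose coordinate \<open>4 * j\<close> is already known from
      \<open>A\<close>.\<close>
    have "?r' ! (4 * j + 2) = ?r ! (4 * j + 2) + v (Suc i) * ?l' ! (4 * j)"
      using incident_coordinates(1)[OF inc(2), of j] incident_coordinates(1)[OF inc(3), of j] that unfolding v' by algebra
    then show ?thesis
      using A[of j] IH(3)[of j] that by (simp add: rho_U del: upt_Suc)
  qed
  have D: "?r' ! (4 * j + 3) = rho (int i - int j - 1) (?V (Suc i) @ [v (Suc i)])"
    if "4 * j + 3 \<le> k" for j
  proof -
    have "?r' ! (4 * j + 3) = ?r ! (4 * j + 3) + v (Suc i) * ?l' ! (4 * j + 1)"
      using incident_coordinates(2)[OF inc(2), of j] incident_coordinates(2)[OF inc(3), of j] that unfolding v' by algebra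
    then show ?thesis
      using B[of j] IH(4)[of j] that by (simp add: rho_V_v del: upt_Suc)
  qed
  \<comment> \<open>As for \<open>A\<close> with \<open>j = 0\<close>: the coefficient of
    \<open>v (Suc i)\<close> is 1 by \<open>rho_full\<close>.\<close>
  have "?r' ! 0 = rho (int i) (?V (Suc i) @ [v (Suc i)])"
    using v' IH(5) by (simp add: rho_V_v rho_full len del: upt_Suc)
  then show ?case
    using A B C D by (simp del: upt_Suc)
qed

section \<open>From the chain to the walk in the graph\<close>

theorem theorem1:
  fixes k :: nat
    and N :: enat
    and w :: "nat \<Rightarrow> 'a::{finite,field} list + 'a list"
    and l r :: "nat \<Rightarrow> 'a list"
    and x y u v :: "nat \<Rightarrow> 'a"
  assumes "k \<ge> 2"
    and "backtrackless_walk k N w"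
    and "N \<ge> 2"
    and "\<And>i. i \<ge> 1 \<Longrightarrow> enat (2 * i - 1) \<le> N \<Longrightarrow> w (2 * i - 1) = Inl (l i)"
    and "\<And>i. i \<ge> 1 \<Longrightarrow> enat (2 * i) \<le> N \<Longrightarrow> w (2 * i) = Inr (r i)"
    and "l 1 = replicate (k + 1) 0"
    and "r 1 = replicate (k + 1) 0"
    and "\<And>i. x i = l i ! 0"
    and "\<And>i. y i = r i ! 0"
    and "\<And>i. u i = x (i + 1) - x i"
    and "\<And>i. v i = y (i + 1) - y i"
  shows "\<forall>i j. i \<ge> 1 \<and> enat (2 * (i + 1)) \<le> N \<longrightarrow>
    (4 * j \<le> k \<longrightarrow>
      l (i + 1) ! (4 * j) =
        rho (int i - int j - 1) (concat (map (\<lambda>m. [u m, v m]) [1..<i]) @ [u i])) \<and>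
    (4 * j + 1 \<le> k \<longrightarrow>
      l (i + 1) ! (4 * j + 1) =
        rho (int i - int j - 2) (concat (map (\<lambda>m. [v m, u (m + 1)]) [1..<i]))) \<and>
    (4 * j + 2 \<le> k \<longrightarrow>
      l (i + 1) ! (4 * j + 2) =
        y (i + 1) * l (i + 1) ! (4 * j) -
        rho (int i - int j - 1) (concat (map (\<lambda>m. [u m, v m]) [1..<i + 1]))) \<and>
    (4 * j + 3 \<le> k \<longrightarrow>
      l (i + 1) ! (4 * j + 3) =
        y (i + 1) * l (i + 1) ! (4 * j + 1) -
        rho (int i - int j - 2) (concat (map (\<lambda>m. [v m, u (m + 1)]) [1..<i]) @ [v i]))"
proof (intro allI impI)
  fix i j :: nat
  assume ij: "i \<ge> 1 \<and> enat (2 * (i + 1)) \<le> N"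
  have adj: "Lambda_adj k (w n) (w (n + 1))" if "n \<ge> 1" "n + 1 \<le> 2 * (i + 1)" for n
  proof -
    have "enat (n + 1) \<le> N"
      using that ij by (meson enat_ord_simps(1) order_trans)
    then show ?thesis
      using assms(2) that by (simp add: backtrackless_walk_def)
  qed
  have wl: "w (2 * m - 1) = Inl (l m)" and wr: "w (2 * m) = Inr (r m)"
    if "1 \<le> m" "m \<le> i + 1" for m
  proof -
    have "enat (2 * m - 1) \<le> enat (2 * (i + 1))" "enat (2 * m) \<le> enat (2 * (i + 1))"
      using that by auto
    then show "w (2 * m - 1) = Inl (l m)" "w (2 * m) = Inr (r m)"
      using assms(4,5)[of m] that ij by (meson order_trans)+
  qed
  \<comment> \<open>Positions \<open>2 * m - 1\<close> and \<open>2 * m\<close> are adjacent, and so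
    are \<open>2 * m\<close> and \<open>2 * (m + 1) - 1\<close>; this yields the two kinds of
    incidence in the chain.\<close>
  have same: "incident k (l m) (r m)" "l m ! 1 = l m ! 2" if "1 \<le> m" "m \<le> i + 1" for m
    using adj[of "2 * m - 1"] wl[OF that] wr[OF that] that
    by (auto simp: Lambda_adj_def L_vecs_def)
  have succ: "incident k (l (m + 1)) (r m)" if "1 \<le> m" "m < i + 1" for m
    using adj[of "2 * m"] wl[of "m + 1"] wr[of m] that by (auto simp: Lambda_adj_def)
  have inc: "incident k (l (i + 1)) (r (i + 1))"
    using same by simp
  \<comment> \<open>The chain lemma determines these coordinates of \<open>r (i + 1)\<close>;
    incidence with \<open>l (i + 1)\<close> transfers them to the left vector.\<close>
  have rel2: "l (i + 1) ! (4 * j + 2) = y (i + 1) * l (i + 1) ! (4 * j) - r (i + 1) ! (4 * j + 2)"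
    if "4 * j + 2 \<le> k"
    using incident_coordinates(1)[OF inc that] by (simp add: assms(9) eq_diff_eq)
  have rel3: "l (i + 1) ! (4 * j + 3) = y (i + 1) * l (i + 1) ! (4 * j + 1) - r (i + 1) ! (4 * j + 3)"
    if "4 * j + 3 \<le> k"
    using incident_coordinates(2)[OF inc that] by (simp add: assms(9) eq_diff_eq)
  have uv: "\<And>m. u m = l (m + 1) ! 0 - l m ! 0" "\<And>m. v m = r (m + 1) ! 0 - r m ! 0"
    using assms(8-11) by simp_all
  \<comment> \<open>\<open>less_add_one\<close> fixes the length of the chain as
    \<open>M = i + 1\<close>.\<close>
  have coords: "(4 * j \<le> k \<longrightarrow> l (i + 1) ! (4 * j) =
        rho (int i - int j - 1) (concat (map (\<lambda>m. [u m, v m]) [1..<i]) @ [u i]))"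
    "(4 * j + 1 \<le> k \<longrightarrow> l (i + 1) ! (4 * j + 1) =
        rho (int i - int j - 2) (concat (map (\<lambda>m. [v m, u (m + 1)]) [1..<i])))"
    "(4 * j + 2 \<le> k \<longrightarrow> r (i + 1) ! (4 * j + 2) =
        rho (int i - int j - 1) (concat (map (\<lambda>m. [u m, v m]) [1..<i + 1])))"
    "(4 * j + 3 \<le> k \<longrightarrow> r (i + 1) ! (4 * j + 3) =
        rho (int i - int j - 2) (concat (map (\<lambda>m. [v m, u (m + 1)]) [1..<i]) @ [v i]))"
    using incident_chain_coordinates[OF assms(1) same(1) succ same(2) assms(6,7) uv less_add_one]
    by blast+
  show "(4 * j \<le> k \<longrightarrow>
      l (i + 1) ! (4 * j) =
        rho (int i - int j - 1) (concat (map (\<lambda>m. [u m, v m]) [1..<i]) @ [u i])) \<and>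
    (4 * j + 1 \<le> k \<longrightarrow>
      l (i + 1) ! (4 * j + 1) =
        rho (int i - int j - 2) (concat (map (\<lambda>m. [v m, u (m + 1)]) [1..<i]))) \<and>
    (4 * j + 2 \<le> k \<longrightarrow>
      l (i + 1) ! (4 * j + 2) =
        y (i + 1) * l (i + 1) ! (4 * j) -
        rho (int i - int j - 1) (concat (map (\<lambda>m. [u m, v m]) [1..<i + 1]))) \<and>
    (4 * j + 3 \<le> k \<longrightarrow>
      l (i + 1) ! (4 * j + 3) =
        y (i + 1) * l (i + 1) ! (4 * j + 1) -
        rho (int i - int j - 2) (concat (map (\<lambda>m. [v m, u (m + 1)]) [1..<i]) @ [v i]))"
    using coords rel2 rel3 by (intro conjI impI) simp_all
qed

end
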